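(* Let $\mathbf{A}\in\mathbb{R}^{m\times n}$, $\mathbf{b}\in\mathbb{R}^m$, $\mathbf{c},\mathbf{d}\in\mathbb{R}^n$, $\alpha,\beta\in\mathbb{R}$ be such that $X=\{\mathbf{x}\in\mathbb{R}^n \mid \mathbf{A}\mathbf{x}\le\mathbf{b},\ \mathbf{x}\ge\mathbf{0}_n\}$ is non-empty and bounded and $\mathbf{d}^T\mathbf{x}+\beta>0$ for all $\mathbf{x}\in X$. Let $F_P^*$, $F_D^*$ be the sets of optimal solutions of the linear programs (P) and (D) given in the context. Let $(p^*,q^*,\bar{\mathbf{x}}^{1*},\bar{\mathbf{x}}^{2*},\bar{\mathbf{u}}^{1*},\bar{\mathbf{u}}^{2*},\mathbf{y}^{1*},\mathbf{y}^{2*},\mathbf{v}^{1*},\mathbf{v}^{2*},w^{1*},w^{2*})$ be an optimal solution of the linear program (with $q\in\mathbb{R}$ free) $$\begin{aligned}\max\ & \sum_{j=1}^n \bar{x}_j^2+\sum_{i=1}^m\bar{u}_i^2+\sum_{i=1}^m y_i^2+\sum_{j=1}^n v_j^2+w^2\\ \text{s.t. } & \mathbf{A}(\bar{\mathbf{x}}^1+\bar{\mathbf{x}}^2)-\mathbf{b}p+\bar{\mathbf{u}}^1+\bar{\mathbf{u}}^2=\mathbf{0}_m,\\ & \mathbf{d}^T(\bar{\mathbf{x}}^1+\bar{\mathbf{x}}^2)+\beta p-(w^1+w^2)=0,\\ & \mathbf{A}^T(\mathbf{y}^1+\mathbf{y}^2)+\mathbf{d}q-(\mathbf{v}^1+\mathbf{v}^2)-\mathbf{c}(w^1+w^2)=\mathbf{0}_n,\\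 & -\mathbf{b}^T(\mathbf{y}^1+\mathbf{y}^2)+\beta q-\alpha(w^1+w^2)=0,\\ & \mathbf{c}^T(\bar{\mathbf{x}}^1+\bar{\mathbf{x}}^2)+\alpha p-q=0,\\ & p\ge0,\ (\bar{\mathbf{x}}^1,\bar{\mathbf{u}}^1,\mathbf{y}^1,\mathbf{v}^1,w^1)\ge\mathbf{0}_{2m+2n+1},\ \mathbf{0}_{2m+2n+1}\le(\bar{\mathbf{x}}^2,\bar{\mathbf{u}}^2,\mathbf{y}^2,\mathbf{v}^2,w^2)\le\mathbf{1}_{2m+2n+1}.\end{aligned}$$ Then $$(\bar{\mathbf{x}}^*,t^*,\bar{\mathbf{u}}^* ):=\frac{1}{w^{1*}+1}\left(\bar{\mathbf{x}}^{1*}+\bar{\mathbf{x}}^{2*},\ p^*,\ \bar{\mathbf{u}}^{1*}+\bar{\mathbf{u}}^{2*}\right)\in ri(F_P^* ),$$ $$(\mathbf{y}^*,z^*,\mathbf{v}^* ):=\frac{1}{w^{1*}+1}\left(\mathbf{y}^{1*}+\mathbf{y}^{2*},\ q^*,\ \mathbf{v}^{1*}+\mathbf{v}^{2*}\right)\in ri(F_D^* ),$$ and consequently $\left(\frac{1}{t^*}(\bar{\mathbf{x}}^*,\bar{\mathbf{u}}^* ),(\mathbf{y}^*,z^*,\mathbf{v}^* )\right)$ is a strict complementary solution for the linear fractional program $\max\{(\mathbf{c}^T\mathbf{x}+\alpha)/(\mathbf{d}^T\mathbf{x}+\beta)\mid \mathbf{x}\in X\}$ and its dual $\min\{z \mid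 \mathbf{A}^T\mathbf{y}+\mathbf{d}z\ge\mathbf{c},\ -\mathbf{b}^T\mathbf{y}+\beta z=\alpha,\ \mathbf{y}\ge\mathbf{0}_m\}$.
   Context: Vector inequalities are componentwise; $\mathbf{0}_k,\mathbf{1}_k\in\mathbb{R}^k$ are the all-zeros and all-ones vectors; $ri(\cdot)$ is the relative interior of a convex set. The superscripts $1,2$ on variables are labels of distinct variables, not powers: $\bar{x}_j^2$ is the $j$-th component of the vector $\bar{\mathbf{x}}^2$, and similarly for the other variables. Program (P), with variables $(\bar{\mathbf{x}},t,\bar{\mathbf{u}})\in\mathbb{R}^n\times\mathbb{R}\times\mathbb{R}^m$: $\max\ \mathbf{c}^T\bar{\mathbf{x}}+\alpha t$ subject to $\mathbf{A}\bar{\mathbf{x}}+\bar{\mathbf{u}}=\mathbf{b}t$, $\mathbf{d}^T\bar{\mathbf{x}}+\beta t=1$, $\bar{\mathbf{x}}\ge\mathbf{0}_n$, $t\ge0$, $\bar{\mathbf{u}}\ge\mathbf{0}_m$. Program (D), with variables $(\mathbf{y},z,\mathbf{v})\in\mathbb{R}^m\times\mathbb{R}\times\mathbb{R}^n$: $\min\ z$ subject to $\mathbf{A}^T\mathbf{y}+\mathbf{d}z-\mathbf{v}=\mathbf{c}$, $-\mathbf{b}^T\mathbf{y}+\beta z=\alpha$, $\mathbf{y}\ge\mathbf{0}_m$, $\mathbf{v}\ge\mathbf{0}_n$ ($z$ free in sign). A feasible primal-dual solution is a pair $\left((\mathbf{x}^*,\mathbf{u}^* ),(\mathbf{y}^*,z^*,\mathbf{v}^*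 )\right)$ where $\mathbf{x}^*$ is feasible for the linear fractional program, $(\mathbf{y}^*,z^* )$ is feasible for its dual, and $\mathbf{u}^*=\mathbf{b}-\mathbf{A}\mathbf{x}^*$, $\mathbf{v}^*=\mathbf{A}^T\mathbf{y}^*+\mathbf{d}z^*-\mathbf{c}$. It is called a strict complementary solution if $\mathbf{x}^{*T}\mathbf{v}^*=0$, $\mathbf{y}^{*T}\mathbf{u}^*=0$, $\mathbf{x}^*+\mathbf{v}^*>\mathbf{0}_n$ and $\mathbf{y}^*+\mathbf{u}^*>\mathbf{0}_m$, the strict inequalities holding in every component. *)

theory Defs
  imports "HOL-Analysis.Analysis"
begin

text \<open>
  On \<open>real ^ 'n\<close> the order \<open>\<le>\<close> is componentwise and \<open>1\<close> is the all-ones vector. The library's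
  strict \<open><\<close> on vectors is \<^emph>\<open>not\<close> componentwise (it is \<open>\<le>\<close> without equality), so
  componentwise strictness is written with an explicit quantifier.
\<close>

definition lfp_feasible :: "real ^ 'n ^ 'm \<Rightarrow> real ^ 'm \<Rightarrow> (real ^ 'n) set" where
  "lfp_feasible A b = {x. A *v x \<le> b \<and> 0 \<le> x}"

definition lfp_dual_feasible ::
    "real ^ 'n ^ 'm \<Rightarrow> real ^ 'm \<Rightarrow> real ^ 'n \<Rightarrow> real ^ 'n \<Rightarrow> real \<Rightarrow> real
      \<Rightarrow> ((real ^ 'm) \<times> real) set" where
  "lfp_dual_feasible A b c d \<alpha> \<beta> =
    {(y, z). c \<le> transpose A *v y + z *\<^sub>R d \<and> - (b \<bullet> y) + \<beta> * z = \<alpha> \<and> 0 \<le> y}"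

definition P_feasible ::
    "real ^ 'n ^ 'm \<Rightarrow> real ^ 'm \<Rightarrow> real ^ 'n \<Rightarrow> real
      \<Rightarrow> ((real ^ 'n) \<times> real \<times> (real ^ 'm)) set" where
  "P_feasible A b d \<beta> =
    {(x, t, u). A *v x + u = t *\<^sub>R b \<and> d \<bullet> x + \<beta> * t = 1 \<and> 0 \<le> x \<and> 0 \<le> t \<and> 0 \<le> u}"

definition P_optimal ::
    "real ^ 'n ^ 'm \<Rightarrow> real ^ 'm \<Rightarrow> real ^ 'n \<Rightarrow> real ^ 'n \<Rightarrow> real \<Rightarrow> real
      \<Rightarrow> ((real ^ 'n) \<times> real \<times> (real ^ 'm)) set" where
  "P_optimal A b c d \<alpha> \<beta> =
    {s. is_arg_max (\<lambda>(x, t, u). c \<bullet> x + \<alpha> * t) (\<lambda>s. s \<in> P_feasible A b d \<beta>) s}"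

definition D_feasible ::
    "real ^ 'n ^ 'm \<Rightarrow> real ^ 'm \<Rightarrow> real ^ 'n \<Rightarrow> real ^ 'n \<Rightarrow> real \<Rightarrow> real
      \<Rightarrow> ((real ^ 'm) \<times> real \<times> (real ^ 'n)) set" where
  "D_feasible A b c d \<alpha> \<beta> =
    {(y, z, v). transpose A *v y + z *\<^sub>R d - v = c \<and> - (b \<bullet> y) + \<beta> * z = \<alpha> \<and> 0 \<le> y \<and> 0 \<le> v}"

definition D_optimal ::
    "real ^ 'n ^ 'm \<Rightarrow> real ^ 'm \<Rightarrow> real ^ 'n \<Rightarrow> real ^ 'n \<Rightarrow> real \<Rightarrow> real
      \<Rightarrow> ((real ^ 'm) \<times> real \<times> (real ^ 'n)) set" where
  "D_optimal A b c d \<alpha> \<beta> =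
    {s. is_arg_min (\<lambda>(y, z, v). z) (\<lambda>s. s \<in> D_feasible A b c d \<alpha> \<beta>) s}"

definition feasible_primal_dual ::
    "real ^ 'n ^ 'm \<Rightarrow> real ^ 'm \<Rightarrow> real ^ 'n \<Rightarrow> real ^ 'n \<Rightarrow> real \<Rightarrow> real
      \<Rightarrow> ((real ^ 'n) \<times> (real ^ 'm)) \<times> ((real ^ 'm) \<times> real \<times> (real ^ 'n)) \<Rightarrow> bool" where
  "feasible_primal_dual A b c d \<alpha> \<beta> = (\<lambda>((x, u), (y, z, v)).
     x \<in> lfp_feasible A b \<and> (y, z) \<in> lfp_dual_feasible A b c d \<alpha> \<beta> \<and>
     u = b - A *v x \<and> v = transpose A *v y + z *\<^sub>R d - c)"

definition strict_complementary ::
    "real ^ 'n ^ 'm \<Rightarrow> real ^ 'm \<Rightarrow> real ^ 'n \<Rightarrow> real ^ 'n \<Rightarrow> real \<Rightarrow> real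
      \<Rightarrow> ((real ^ 'n) \<times> (real ^ 'm)) \<times> ((real ^ 'm) \<times> real \<times> (real ^ 'n)) \<Rightarrow> bool" where
  "strict_complementary A b c d \<alpha> \<beta> = (\<lambda>((x, u), (y, z, v)).
     feasible_primal_dual A b c d \<alpha> \<beta> ((x, u), (y, z, v)) \<and>
     x \<bullet> v = 0 \<and> y \<bullet> u = 0 \<and> (\<forall>j. 0 < (x + v) $ j) \<and> (\<forall>i. 0 < (y + u) $ i))"

text \<open>The variables of the auxiliary program, in the order
  \<open>(p, q, x1, x2, u1, u2, y1, y2, v1, v2, w1, w2)\<close>.\<close>

type_synonym ('n, 'm) aux_vars =
  "real \<times> real \<times> (real ^ 'n) \<times> (real ^ 'n) \<times> (real ^ 'm) \<times> (real ^ 'm) \<times> (real ^ 'm) \<times> (real ^ 'm)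
    \<times> (real ^ 'n) \<times> (real ^ 'n) \<times> real \<times> real"

definition aux_feasible ::
    "real ^ 'n ^ 'm \<Rightarrow> real ^ 'm \<Rightarrow> real ^ 'n \<Rightarrow> real ^ 'n \<Rightarrow> real \<Rightarrow> real
      \<Rightarrow> ('n::finite, 'm::finite) aux_vars set" where
  "aux_feasible A b c d \<alpha> \<beta> = {(p, q, x1, x2, u1, u2, y1, y2, v1, v2, w1, w2).
     A *v (x1 + x2) - p *\<^sub>R b + u1 + u2 = 0 \<and>
     d \<bullet> (x1 + x2) + \<beta> * p - (w1 + w2) = 0 \<and>
     transpose A *v (y1 + y2) + q *\<^sub>R d - (v1 + v2) - (w1 + w2) *\<^sub>R c = 0 \<and>
     - (b \<bullet> (y1 + y2)) + \<beta> * q - \<alpha> * (w1 + w2) = 0 \<and>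
     c \<bullet> (x1 + x2) + \<alpha> * p - q = 0 \<and>
     0 \<le> p \<and>
     0 \<le> x1 \<and> 0 \<le> u1 \<and> 0 \<le> y1 \<and> 0 \<le> v1 \<and> 0 \<le> w1 \<and>
     0 \<le> x2 \<and> 0 \<le> u2 \<and> 0 \<le> y2 \<and> 0 \<le> v2 \<and> 0 \<le> w2 \<and>
     x2 \<le> 1 \<and> u2 \<le> 1 \<and> y2 \<le> 1 \<and> v2 \<le> 1 \<and> w2 \<le> 1}"

definition aux_objective :: "('n::finite, 'm::finite) aux_vars \<Rightarrow> real" where
  "aux_objective = (\<lambda>(p, q, x1, x2, u1, u2, y1, y2, v1, v2, w1, w2).
     (\<Sum>j\<in>UNIV. x2 $ j) + (\<Sum>i\<in>UNIV. u2 $ i) + (\<Sum>i\<in>UNIV. y2 $ i) + (\<Sum>j\<in>UNIV. v2 $ j) + w2)"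

end

theory Submission
  imports Defs
begin

text \<open>
  Homogenising (P), (D) and the equality of their objective values by a scale \<open>w\<close> gives a cone
  given by a skew-symmetric system, whose solutions are all complementary: of \<open>x\<^sub>j, v\<^sub>j\<close> and of
  \<open>y\<^sub>i, u\<^sub>i\<close> at least one vanishes. The objective of the auxiliary program is therefore at most
  \<open>n + m + 1\<close>. Tucker's theorem on skew-symmetric systems yields a strictly complementary solution
  with \<open>w > 0\<close>, and a large multiple of it attains this bound by truncating every variable at \<open>1\<close>.
  Hence an optimal solution is strictly complementary with \<open>w2 = 1\<close>. The optimal faces are cut out
  by the vanishing of the complementary variables, so strict positivity of the remaining ones
  means lying in the relative interior.
\<close>

section \<open>Tucker's theorem for skew-symmetric linear maps\<close>

text \<open>Supplies coordinates for the Farkas argument below, where closedness is known for the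
  hull of a finite set. The vectors \<open>f y + s\<close> already form a convex cone containing the
  generators, so the hull lies among them.\<close>

lemma mem_finitely_generated_coneE:
  fixes f :: "'a::ordered_euclidean_space \<Rightarrow> 'a"
  assumes "linear f" and "x \<in> convex_cone hull (Basis \<union> f ` Basis)"
  obtains y s where "0 \<le> y" "0 \<le> s" "x = f y + s"
proof -
  interpret linear f by fact
  let ?C = "{f y + s | y s. 0 \<le> y \<and> 0 \<le> s}"
  have basis: "0 \<le> i" if "i \<in> Basis" for i :: 'a
    using that by (simp add: eucl_le[where 'a='a] inner_Basis)
  have "convex_cone ?C"
    unfolding convex_cone_iff
  proof (intro conjI ballI allI impI)
    show "0 \<in> ?C"
      by (force intro: exI[of _ 0] simp: zero)
    show "x + y \<in> ?C" if "x \<in> ?C" "y \<in> ?C" for x y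
    proof -
      from that obtain a s b t
        where "0 \<le> a" "0 \<le> s" "0 \<le> b" "0 \<le> t" "x = f a + s" "y = f b + t"
        by auto
      then have "x + y = f (a + b) + (s + t)" "0 \<le> a + b" "0 \<le> s + t"
        by (auto simp: add)
      then show ?thesis by blast
    qed
    show "r *\<^sub>R x \<in> ?C" if "x \<in> ?C" "0 \<le> r" for x r
    proof -
      from that obtain a s where "0 \<le> a" "0 \<le> s" "x = f a + s"
        by auto
      with \<open>0 \<le> r\<close> have "r *\<^sub>R x = f (r *\<^sub>R a) + r *\<^sub>R s" "0 \<le> r *\<^sub>R a" "0 \<le> r *\<^sub>R s"
        by (auto simp: scale scaleR_right_distrib intro: scaleR_nonneg_nonneg)
      then show ?thesis by blast
    qed
  qed
  moreover have "Basis \<union> f ` Basis \<subseteq> ?C"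
  proof safe
    fix i :: 'a assume "i \<in> Basis"
    then have "i = f 0 + i" "f i = f i + 0" "0 \<le> i"
      by (simp_all add: zero basis)
    then show "\<exists>y s. i = f y + s \<and> 0 \<le> y \<and> 0 \<le> s" "\<exists>y s. f i = f y + s \<and> 0 \<le> y \<and> 0 \<le> s"
      by blast+
  qed
  ultimately have "convex_cone hull (Basis \<union> f ` Basis) \<subseteq> ?C"
    by (rule hull_minimal[rotated])
  with assms(2) that show thesis by blast
qed

text \<open>One coordinate at a time: for each basis vector \<open>i\<close> there is a solution
  whose \<open>i\<close>-th entry of \<open>w + K w\<close> is positive. Solutions are closed under
  addition, so the sum over the basis works for all \<open>i\<close> at once.\<close>

theorem Tucker_skew_symmetric:
  fixes K :: "'a::ordered_euclidean_space \<Rightarrow> 'a"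
  assumes "linear K" and skew: "\<And>x y. K x \<bullet> y = - (x \<bullet> K y)"
  obtains w where "0 \<le> w" "0 \<le> K w" "\<And>i. i \<in> Basis \<Longrightarrow> 0 < (w + K w) \<bullet> i"
proof -
  interpret linear K by fact
  have ex: "\<exists>w. 0 \<le> w \<and> 0 \<le> K w \<and> 0 < (w + K w) \<bullet> i" if i: "i \<in> Basis" for i
  proof -
    let ?f = "\<lambda>x. - K x"
    let ?C = "convex_cone hull (Basis \<union> ?f ` Basis)"
    have C0: "0 \<in> ?C"
      by (rule convex_cone_hull_contains_0)
    have "linear ?f"
      by (simp add: linear_compose_neg assms)
    \<comment> \<open>Farkas: either \<open>- i = - K y + s\<close>, so that \<open>y\<close> makes the slack of \<open>i\<close> positive, or
      a hyperplane separating \<open>- i\<close> from the cone has a normal whose \<open>i\<close>-th entry is positive.\<close>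
    show ?thesis
    proof (cases "- i \<in> ?C")
      case True
      then obtain y s where ys: "0 \<le> y" "0 \<le> s" "- i = ?f y + s"
        using mem_finitely_generated_coneE \<open>linear ?f\<close> by blast
      then have K: "K y = s + i"
        by (metis add.commute add_diff_cancel_left' diff_eq_eq minus_diff_eq uminus_add_conv_diff)
      have "0 \<le> i"
        using i by (simp add: eucl_le[where 'a='a] inner_Basis)
      then have "0 \<le> K y"
        using K ys by simp
      moreover have "0 \<le> y \<bullet> i" "0 \<le> s \<bullet> i"
        using ys i by (auto simp: eucl_le[where 'a='a])
      then have "0 < (y + K y) \<bullet> i"
        using i K by (simp add: inner_add_left)
      ultimately show ?thesis
        using ys by blast
    next
      case False
      have "closed ?C"
        by (intro closed_convex_cone_hull) simp
      with False obtain a r where a: "a \<bullet> - i < r" "\<And>x. x \<in> ?C \<Longrightarrow> r < a \<bullet> x"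
        using separating_hyperplane_closed_point[of ?C "- i"] convex_convex_cone_hull by blast
      have "r < 0"
        using a(2)[OF C0] by simp
      \<comment> \<open>On a cone the bound \<open>r < 0\<close> improves to 0: a point with
        negative value could be rescaled to have value exactly \<open>r\<close>, which the strict
        separation forbids.\<close>
      have pos: "0 \<le> a \<bullet> x" if "x \<in> ?C" for x
      proof (rule ccontr)
        assume "\<not> 0 \<le> a \<bullet> x"
        then have "a \<bullet> ((r / (a \<bullet> x)) *\<^sub>R x) = r" "0 \<le> r / (a \<bullet> x)"
          using \<open>r < 0\<close> by (auto simp: divide_nonpos_nonpos)
        moreover from this that have "(r / (a \<bullet> x)) *\<^sub>R x \<in> ?C"
          by (intro convex_cone_hull_mul) auto
        ultimately show False
          using a(2) by force
      qed
      have gen: "x \<in> ?C" if "x \<in> Basis \<union> ?f ` Basis" for x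
        using that by (rule hull_inc)
      have "0 \<le> a"
        unfolding eucl_le[where 'a='a] using pos gen by simp
      \<comment> \<open>Skew symmetry turns the inequality for the generator \<open>- K j\<close>
        into one for the \<open>j\<close>-th entry of \<open>K a\<close>.\<close>
      moreover have "0 \<le> K a \<bullet> j" if "j \<in> Basis" for j
        using pos[OF gen, of "?f j"] that by (simp add: skew)
      then have "0 \<le> K a"
        by (simp add: eucl_le[where 'a='a])
      moreover from this have "0 \<le> K a \<bullet> i"
        using i by (simp add: eucl_le[where 'a='a])
      then have "0 < (a + K a) \<bullet> i"
        using a(1) \<open>r < 0\<close> by (simp add: inner_add_left)
      ultimately show ?thesis by blast
    qed
  qed
  then obtain w where w: "\<And>i. i \<in> Basis \<Longrightarrow> 0 \<le> w i \<and> 0 \<le> K (w i) \<and> 0 < (w i + K (w i)) \<bullet> i"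
    by metis
  let ?w = "\<Sum>i\<in>Basis. w i"
  have "0 \<le> ?w" "0 \<le> K ?w"
    using w by (auto simp: sum intro: sum_nonneg)
  moreover have "0 < (?w + K ?w) \<bullet> i" if i: "i \<in> Basis" for i
  proof -
    have "(?w + K ?w) \<bullet> i = (\<Sum>j\<in>Basis. (w j + K (w j)) \<bullet> i)"
      by (simp add: sum inner_sum_left flip: sum.distrib)
    also have "0 < \<dots>"
    proof (rule sum_pos2[OF _ i])
      show "0 \<le> (w j + K (w j)) \<bullet> i" if "j \<in> Basis" for j
        using w[OF that] i by (simp add: inner_add_left eucl_le[where 'a='a])
    qed (use w i in auto)
    finally show ?thesis .
  qed
  ultimately show thesis
    by (rule that)
qed

section \<open>Relative interiors and open conditions\<close>

text \<open>The affine hull of \<open>S\<close> lies in \<open>L\<close>, so a small ball inside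
  \<open>U\<close> meets it only in \<open>S\<close>. Below, \<open>L\<close> collects the equations
  of an optimal face and \<open>U\<close> the strict inequalities that hold at the point.\<close>

lemma rel_interior_affine_Int_open:
  fixes S :: "'a::euclidean_space set"
  assumes "x \<in> S" "S \<subseteq> L" "affine L" "open U" "x \<in> U" "U \<inter> L \<subseteq> S"
  shows "x \<in> rel_interior S"
proof -
  obtain e where "e > 0" "ball x e \<subseteq> U"
    using assms openE by blast
  moreover have "affine hull S \<subseteq> L"
    using assms by (simp add: hull_minimal)
  ultimately show ?thesis
    using assms by (force simp: mem_rel_interior_ball)
qed

lemma open_Collect_all_finite:
  fixes P :: "'i::finite \<Rightarrow> 'a::topological_space \<Rightarrow> bool"
  assumes "\<And>i. open {x. P i x}"
  shows "open {x. \<forall>i. P i x}"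
  using assms by (simp add: Collect_all_eq open_INT)

section \<open>Recession directions, duality gap and complementarity\<close>

text \<open>A nonzero \<open>r\<close> would be a recession direction, and a ray from a feasible
  point leaves every ball. This is what rules out solutions with homogenising variable
  \<open>t\<close> or \<open>p\<close> equal to 0.\<close>

lemma bounded_lfp_recession_zero:
  assumes "lfp_feasible A b \<noteq> {}" "bounded (lfp_feasible A b)"
    and r: "A *v r \<le> 0" "0 \<le> r"
  shows "r = 0"
proof (rule ccontr)
  assume "r \<noteq> 0"
  obtain x0 where x0: "A *v x0 \<le> b" "0 \<le> x0"
    using assms by (auto simp: lfp_feasible_def)
  obtain B where B: "\<And>x. x \<in> lfp_feasible A b \<Longrightarrow> norm x \<le> B"
    using assms by (auto simp: bounded_iff)
  \<comment> \<open>Chosen so that \<open>k *\<^sub>R r\<close> has norm larger than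
    \<open>B + norm x0\<close>, which the triangle inequality contradicts.\<close>
  define k where "k = (\<bar>B\<bar> + norm x0 + 1) / norm r"
  have "0 \<le> k"
    by (simp add: k_def)
  have "A *v (x0 + k *\<^sub>R r) = A *v x0 + k *\<^sub>R (A *v r)"
    by (simp add: matrix_vector_right_distrib matrix_vector_mult_scaleR)
  also have "\<dots> \<le> b + 0"
    by (intro add_mono x0 scaleR_nonneg_nonpos \<open>0 \<le> k\<close> r)
  finally have "x0 + k *\<^sub>R r \<in> lfp_feasible A b"
    using x0 r \<open>0 \<le> k\<close> by (simp add: lfp_feasible_def scaleR_nonneg_nonneg)
  then have "norm (x0 + k *\<^sub>R r) \<le> B"
    by (rule B)
  moreover have "norm (k *\<^sub>R r) \<le> norm (x0 + k *\<^sub>R r) + norm x0"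
    by (metis add_diff_cancel_left' norm_triangle_ineq4 add.commute)
  moreover have "norm (k *\<^sub>R r) = \<bar>B\<bar> + norm x0 + 1"
    using \<open>r \<noteq> 0\<close> \<open>0 \<le> k\<close> by (simp add: k_def)
  ultimately show False by simp
qed

text \<open>After substituting the slacks, the terms in \<open>A\<close> cancel by adjointness. The
  scales \<sigma> and \<tau> are independent so that one identity serves (P) and (D), the
  homogeneous system, and mixed pairs of an unscaled point with a homogeneous one.\<close>

lemma duality_gap_homogeneous:
  fixes A :: "real ^ 'n ^ 'm"
  assumes "A *v x + u = t *\<^sub>R b" "d \<bullet> x + \<beta> * t = \<sigma>"
    and "transpose A *v y + z *\<^sub>R d - v = \<tau> *\<^sub>R c" "- (b \<bullet> y) + \<beta> * z = \<alpha> * \<tau>"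
  shows "x \<bullet> v + y \<bullet> u = \<sigma> * z - \<tau> * (c \<bullet> x + \<alpha> * t)"
proof -
  have v: "v = transpose A *v y + z *\<^sub>R d - \<tau> *\<^sub>R c" and u: "u = t *\<^sub>R b - A *v x"
    using assms by (auto simp: algebra_simps)
  have adj: "x \<bullet> (transpose A *v y) = y \<bullet> (A *v x)"
    by (metis dot_lmul_matrix inner_commute transpose_matrix_vector)
  have "x \<bullet> v = y \<bullet> (A *v x) + z * (d \<bullet> x) - \<tau> * (c \<bullet> x)"
    unfolding v inner_add_right inner_diff_right adj by (simp add: inner_commute)
  moreover have "y \<bullet> u = t * (b \<bullet> y) - y \<bullet> (A *v x)"
    unfolding u by (simp add: inner_diff_right inner_commute)
  moreover have "d \<bullet> x = \<sigma> - \<beta> * t" "b \<bullet> y = \<beta> * z - \<alpha> * \<tau>"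
    using assms by auto
  ultimately show ?thesis
    by (simp add: algebra_simps)
qed

lemma nonneg_inner_eq_0D:
  fixes x y :: "real ^ 'n"
  assumes "x \<bullet> y = 0" "0 \<le> x" "0 \<le> y"
  shows "x $ j * y $ j = 0"
proof -
  have "(\<Sum>j\<in>UNIV. x $ j * y $ j) = 0"
    using assms by (simp add: inner_vec_def)
  moreover have "0 \<le> x $ j * y $ j" for j
    using assms by (simp add: less_eq_vec_def)
  ultimately show ?thesis
    by (simp add: sum_nonneg_eq_0_iff)
qed

lemma nonneg_inner_sum_eq_0:
  fixes x v :: "real ^ 'n" and y u :: "real ^ 'm"
  assumes "x \<bullet> v + y \<bullet> u = 0" "0 \<le> x" "0 \<le> v" "0 \<le> y" "0 \<le> u"
  shows "x \<bullet> v = 0" "y \<bullet> u = 0"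
  using inner_nonneg_nonneg[of x v] inner_nonneg_nonneg[of y u] assms by auto

section \<open>The homogeneous self-dual system\<close>

text \<open>The free variable \<open>q\<close> is split as \<open>q1 - q2\<close>, which turns the equation
  \<open>w = d \<bullet> x + \<beta> * p\<close> into two opposite inequalities.\<close>

definition self_dual_map ::
    "real ^ 'n ^ 'm \<Rightarrow> real ^ 'm \<Rightarrow> real ^ 'n \<Rightarrow> real ^ 'n \<Rightarrow> real \<Rightarrow> real
      \<Rightarrow> (real ^ 'n) \<times> (real ^ 'm) \<times> real \<times> real \<times> real \<times> real
      \<Rightarrow> (real ^ 'n) \<times> (real ^ 'm) \<times> real \<times> real \<times> real \<times> real" where
  "self_dual_map A b c d \<alpha> \<beta> = (\<lambda>(x, y, p, q1, q2, w).
     (transpose A *v y + (q1 - q2) *\<^sub>R d - w *\<^sub>R c,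
      p *\<^sub>R b - A *v x,
      - (b \<bullet> y) + \<beta> * (q1 - q2) - \<alpha> * w,
      w - d \<bullet> x - \<beta> * p,
      - (w - d \<bullet> x - \<beta> * p),
      c \<bullet> x + \<alpha> * p - (q1 - q2)))"

lemma linear_self_dual_map: "linear (self_dual_map A b c d \<alpha> \<beta>)"
  by (rule linearI)
    (auto simp: self_dual_map_def split_beta vec.add vec.scale scalar_mult_eq_scaleR
      inner_add_right algebra_simps simp del: transpose_matrix_vector)

text \<open>Every coefficient couples two variables and occurs twice with opposite signs:
  \<open>A\<close> couples \<open>x\<close> with \<open>y\<close>, \<open>b\<close> couples
  \<open>p\<close> with \<open>y\<close>, and likewise for the others; the two copies of
  \<open>A\<close> match by adjointness.\<close>

lemma skew_self_dual_map:
  "self_dual_map A b c d \<alpha> \<beta> s \<bullet> s' = - (s \<bullet> self_dual_map A b c d \<alpha> \<beta> s')"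
proof -
  obtain x y p q1 q2 w x' y' p' q1' q2' w'
    where s: "s = (x, y, p, q1, q2, w)" "s' = (x', y', p', q1', q2', w')"
    by (metis prod.exhaust)
  have adj: "(transpose A *v y) \<bullet> x = y \<bullet> (A *v x)" for x y
    by (simp add: dot_lmul_matrix)
  have "x \<bullet> (transpose A *v y') = y' \<bullet> (A *v x)" "(A *v x) \<bullet> y' = y' \<bullet> (A *v x)"
    using adj by (simp_all add: inner_commute)
  then show ?thesis
    unfolding s self_dual_map_def
    by (simp del: transpose_matrix_vector add: inner_diff_left inner_diff_right inner_add_left
        inner_add_right adj inner_commute[of x c] inner_commute[of x d] inner_commute[of y b])
      (simp add: algebra_simps)
qed

text \<open>Tucker's theorem leaves open only that \<open>w\<close> is positive and that the
  residuals \<open>rp\<close> and \<open>rw\<close> vanish. The residuals are complementary to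
  \<open>p\<close> and \<open>w\<close>, so it suffices that \<open>p\<close> and \<open>w\<close>
  are nonzero; the assumptions on the feasible set ensure this.\<close>

lemma exists_strictly_complementary:
  fixes A :: "real ^ 'n ^ 'm"
  assumes X: "lfp_feasible A b \<noteq> {}" "bounded (lfp_feasible A b)"
    and pos: "\<forall>x \<in> lfp_feasible A b. d \<bullet> x + \<beta> > 0"
  obtains x u y v p q w where
    "A *v x + u = p *\<^sub>R b" "d \<bullet> x + \<beta> * p = w"
    "transpose A *v y + q *\<^sub>R d - v = w *\<^sub>R c" "- (b \<bullet> y) + \<beta> * q = \<alpha> * w"
    "c \<bullet> x + \<alpha> * p = q" "0 \<le> p" "0 \<le> x" "0 \<le> u" "0 \<le> y" "0 \<le> v" "0 < w"
    "\<And>j. 0 < (x + v) $ j" "\<And>i. 0 < (y + u) $ i"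
proof -
  let ?K = "self_dual_map A b c d \<alpha> \<beta>"
  obtain s where s: "0 \<le> s" "0 \<le> ?K s" "\<And>i. i \<in> Basis \<Longrightarrow> 0 < (s + ?K s) \<bullet> i"
    using Tucker_skew_symmetric[OF linear_self_dual_map skew_self_dual_map] by metis
  obtain x y p q1 q2 w where sdef: "s = (x, y, p, q1, q2, w)"
    by (metis prod.exhaust)
  define q where "q = q1 - q2"
  define v where "v = transpose A *v y + q *\<^sub>R d - w *\<^sub>R c"
  define u where "u = p *\<^sub>R b - A *v x"
  define rp where "rp = - (b \<bullet> y) + \<beta> * q - \<alpha> * w"
  define rw where "rw = c \<bullet> x + \<alpha> * p - q"
  have K: "?K s = (v, u, rp, w - d \<bullet> x - \<beta> * p, - (w - d \<bullet> x - \<beta> * p), rw)"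
    by (simp add: sdef self_dual_map_def v_def u_def rp_def rw_def q_def)
  have nn: "0 \<le> x" "0 \<le> y" "0 \<le> p" "0 \<le> w" "0 \<le> v" "0 \<le> u" "0 \<le> rp" "0 \<le> rw"
    and w: "d \<bullet> x + \<beta> * p = w"
    using s(1,2) unfolding K unfolding sdef by (auto simp: zero_prod_def)
  have xv: "0 < (x + v) $ j" for j
    using s(3)[of "(axis j 1, 0)"] unfolding K unfolding sdef
    by (simp add: in_Basis_prod_iff axis_in_Basis_iff inner_axis)
  have yu: "0 < (y + u) $ i" for i
    using s(3)[of "(0, axis i 1, 0)"] unfolding K unfolding sdef
    by (simp add: in_Basis_prod_iff axis_in_Basis_iff inner_axis zero_prod_def)
  have prp: "0 < p + rp"
    using s(3)[of "(0, 0, 1, 0)"] unfolding K unfolding sdef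
    by (simp add: in_Basis_prod_iff zero_prod_def)
  have wrw: "0 < w + rw"
    using s(3)[of "(0, 0, 0, 0, 0, 1)"] unfolding K unfolding sdef
    by (simp add: in_Basis_prod_iff zero_prod_def)
  have w0: "w - d \<bullet> x - \<beta> * p = 0"
    using w by simp
  \<comment> \<open>By skew symmetry the form vanishes at \<open>s\<close>. The \<open>q1\<close>
    and \<open>q2\<close> terms drop out by \<open>w0\<close>, and the four remaining products are
    nonnegative, so each is 0.\<close>
  have "s \<bullet> ?K s = 0"
    using skew_self_dual_map[of A b c d \<alpha> \<beta> s s] by (simp add: inner_commute)
  then have "x \<bullet> v + y \<bullet> u + p * rp + w * rw = 0"
    unfolding K unfolding sdef using w0 by simp
  moreover have "0 \<le> x \<bullet> v" "0 \<le> y \<bullet> u" "0 \<le> p * rp" "0 \<le> w * rw"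
    using nn by (auto intro: inner_nonneg_nonneg)
  ultimately have comp: "p * rp = 0" "w * rw = 0"
    by linarith+
  have x0: "x = 0" if "p = 0"
  proof (rule bounded_lfp_recession_zero[OF X])
    show "A *v x \<le> 0"
      using nn(6) that by (simp add: u_def)
  qed fact
  \<comment> \<open>If \<open>w = 0\<close>, strictness gives \<open>0 < rw\<close>. The denominator
    condition excludes \<open>p > 0\<close>, and the remaining dual part, with \<open>q < 0\<close>,
    would have a negative gap against a feasible \<open>x'\<close>.\<close>
  have "w \<noteq> 0"
  proof
    assume "w = 0"
    then have "0 < rw"
      using wrw by simp
    \<comment> \<open>Otherwise \<open>x / p\<close> is feasible, while \<open>w = 0\<close> makes
      its denominator vanish.\<close>
    have "p = 0"
    proof (rule ccontr)
      assume "p \<noteq> 0"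
      with nn have "p > 0" by simp
      have "A *v x \<le> p *\<^sub>R b"
        using nn(6) by (simp add: u_def)
      then have "(1 / p) *\<^sub>R (A *v x) \<le> (1 / p) *\<^sub>R (p *\<^sub>R b)"
        using \<open>p > 0\<close> by (intro scaleR_left_mono) auto
      then have "(1 / p) *\<^sub>R x \<in> lfp_feasible A b"
        using \<open>p > 0\<close> nn by (simp add: lfp_feasible_def matrix_vector_mult_scaleR scaleR_nonneg_nonneg)
      with pos have "0 < d \<bullet> x / p + \<beta>"
        by force
      with \<open>p > 0\<close> have "0 < d \<bullet> x + \<beta> * p"
        by (simp add: field_simps)
      with w \<open>w = 0\<close> show False by simp
    qed
    with x0 have "q < 0"
      using \<open>0 < rw\<close> by (simp add: rw_def)
    obtain x' where x': "x' \<in> lfp_feasible A b"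
      using X by blast
    then have "0 \<le> x'" "0 \<le> b - A *v x'"
      by (auto simp: lfp_feasible_def)
    then have "0 \<le> x' \<bullet> v" "0 \<le> y \<bullet> (b - A *v x')"
      using nn by (auto intro: inner_nonneg_nonneg)
    \<comment> \<open>Here \<open>w = 0\<close>: the point is dual feasible for the cost data \<open>c = 0\<close>, \<open>\<alpha> = rp\<close>.\<close>
    moreover have "x' \<bullet> v + y \<bullet> (b - A *v x') = (d \<bullet> x' + \<beta>) * q - rp"
      using \<open>w = 0\<close>
      by (intro duality_gap_homogeneous[of A x' "b - A *v x'" 1 b d \<beta> "d \<bullet> x' + \<beta>" y q v 1 0 rp, simplified])
        (simp_all add: v_def rp_def)
    moreover have "(d \<bullet> x' + \<beta>) * q < 0"
      using pos x' \<open>q < 0\<close> by (simp add: mult_pos_neg)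
    moreover have "0 < rp"
      using prp \<open>p = 0\<close> by simp
    ultimately show False by linarith
  qed
  then have "0 < w" "rw = 0"
    using nn comp by auto
  \<comment> \<open>With \<open>p = 0\<close> also \<open>x = 0\<close>, and then
    \<open>w = d \<bullet> x + \<beta> * p\<close> would be 0.\<close>
  moreover have "p \<noteq> 0"
    using x0 w \<open>w \<noteq> 0\<close> by auto
  with comp have "rp = 0" by simp
  ultimately show thesis
    using nn w xv yu by (intro that[of x u p w y q v]) (auto simp: u_def v_def rp_def rw_def)
qed

section \<open>The optimal value of the auxiliary program\<close>

lemma ex_scale_ge_1:
  fixes S :: "real set"
  assumes "finite S"
  obtains k where "0 \<le> k" "\<And>a. a \<in> S \<Longrightarrow> 0 < a \<Longrightarrow> 1 \<le> k * a"
proof -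
  \<comment> \<open>The largest reciprocal; inserting 0 keeps it nonnegative and covers empty
    \<open>S\<close>.\<close>
  let ?k = "Max (insert 0 (inverse ` S))"
  have "1 \<le> ?k * a" if "a \<in> S" "0 < a" for a
  proof -
    have "inverse a \<le> ?k"
      using assms that by (intro Max_ge) auto
    then have "inverse a * a \<le> ?k * a"
      using that by (intro mult_right_mono) auto
    then show ?thesis
      using that by simp
  qed
  then show thesis
    using assms by (intro that[of ?k]) auto
qed

text \<open>Grouped by complementary pairs, because the bound 1 holds for each pair and not only for
  each variable.\<close>

lemma aux_objective_pairs:
  "aux_objective (p, q, x1, x2, u1, u2, y1, y2, v1, v2, w1, w2) =
     (\<Sum>j\<in>UNIV. x2 $ j + v2 $ j) + (\<Sum>i\<in>UNIV. y2 $ i + u2 $ i) + w2"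
  by (simp add: aux_objective_def sum.distrib)

lemma aux_feasible_large:
  fixes A :: "real ^ 'n ^ 'm"
  assumes "lfp_feasible A b \<noteq> {}" "bounded (lfp_feasible A b)"
    and "\<forall>x \<in> lfp_feasible A b. d \<bullet> x + \<beta> > 0"
  obtains s where "s \<in> aux_feasible A b c d \<alpha> \<beta>" "real CARD('n) + real CARD('m) + 1 \<le> aux_objective s"
proof -
  obtain x u y v p q w where *:
    "A *v x + u = p *\<^sub>R b" "d \<bullet> x + \<beta> * p = w"
    "transpose A *v y + q *\<^sub>R d - v = w *\<^sub>R c" "- (b \<bullet> y) + \<beta> * q = \<alpha> * w"
    "c \<bullet> x + \<alpha> * p = q"
    and nn: "0 \<le> p" "0 \<le> x" "0 \<le> u" "0 \<le> y" "0 \<le> v" "0 < w"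
    and xv: "\<And>j. 0 < (x + v) $ j" and yu: "\<And>i. 0 < (y + u) $ i"
    by (rule exists_strictly_complementary[OF assms, of c \<alpha>]) (rule that)
  obtain k where k: "0 \<le> k" "\<And>a. a \<in> insert w (range (($) x) \<union> range (($) u) \<union> range (($) y) \<union> range (($) v))
      \<Longrightarrow> 0 < a \<Longrightarrow> 1 \<le> k * a"
    by (rule ex_scale_ge_1[of "insert w (range (($) x) \<union> range (($) u) \<union> range (($) y) \<union> range (($) v))"])
      auto
  \<comment> \<open>Each scaled variable is split into its part capped at 1 and the nonnegative
    remainder. The equations see only the sums of the two parts, so they follow by
    homogeneity.\<close>
  let ?t = "\<lambda>r. inf (k *\<^sub>R r) 1"
  let ?s = "(k * p, k * q, k *\<^sub>R x - ?t (x), ?t x, k *\<^sub>R u - ?t u, ?t u, k *\<^sub>R y - ?t y, ?t y,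
    k *\<^sub>R v - ?t v, ?t v, k * w - inf (k * w) 1, inf (k * w) 1)"
  have inf_nn: "0 \<le> ?t r" if "0 \<le> r" for r :: "real ^ 'k"
    using that k by (intro le_infI scaleR_nonneg_nonneg) (simp_all add: less_eq_vec_def)
  have one_nn: "(0 :: real ^ 'k) \<le> 1" for k
    by (simp add: less_eq_vec_def)
  have "k *\<^sub>R (A *v x) + k *\<^sub>R u = (k * p) *\<^sub>R b"
    using *(1) by (metis scaleR_add_right scaleR_scaleR)
  then have "k *\<^sub>R (A *v x) - (k * p) *\<^sub>R b + k *\<^sub>R u = 0"
    by (simp add: algebra_simps)
  moreover have "k * (d \<bullet> x) + \<beta> * (k * p) = k * w"
    by (simp add: algebra_simps flip: *(2))
  moreover have "k *\<^sub>R (transpose A *v y) + (k * q) *\<^sub>R d - k *\<^sub>R v = (k * w) *\<^sub>R c"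
    using *(3) by (metis scaleR_add_right scaleR_diff_right scaleR_scaleR)
  moreover have "- (k * (b \<bullet> y)) + \<beta> * (k * q) = \<alpha> * (k * w)"
    using arg_cong[OF *(4), of "\<lambda>r. k * r"] by (simp add: algebra_simps)
  moreover have "k * (c \<bullet> x) + \<alpha> * (k * p) = k * q"
    by (simp add: algebra_simps flip: *(5))
  ultimately have feas: "?s \<in> aux_feasible A b c d \<alpha> \<beta>"
    unfolding aux_feasible_def using nn k(1)
    by (simp add: inf_nn one_nn scaleR_nonneg_nonneg matrix_vector_mult_scaleR add.assoc del: transpose_matrix_vector)
  \<comment> \<open>One of the two entries is positive; the choice of \<open>k\<close> lifts it to
    at least 1, so its capped part is exactly 1.\<close>
  have pair: "1 \<le> ?t r $ j + ?t r' $ j"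
    if "0 \<le> r" "0 \<le> r'" "0 < (r + r') $ j"
      and "0 < r $ j \<Longrightarrow> 1 \<le> k * r $ j" "0 < r' $ j \<Longrightarrow> 1 \<le> k * r' $ j"
    for r r' :: "real ^ 'k" and j
  proof -
    have "0 \<le> ?t r $ j" "0 \<le> ?t r' $ j"
      using inf_nn that(1,2) by (auto simp: less_eq_vec_def)
    moreover have "0 < r $ j \<or> 0 < r' $ j"
      using that(3) by auto
    ultimately show ?thesis
      using that(4,5) by (auto simp: inf_vec_def inf_real_def)
  qed
  have "1 \<le> k * w"
    using k(2) nn by blast
  have "(\<Sum>j\<in>(UNIV :: 'n set). 1) \<le> (\<Sum>j\<in>UNIV. ?t x $ j + ?t v $ j)"
    using nn xv k(2) by (intro sum_mono pair) blast+
  moreover have "(\<Sum>i\<in>(UNIV :: 'm set). 1) \<le> (\<Sum>i\<in>UNIV. ?t y $ i + ?t u $ i)"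
    using nn yu k(2) by (intro sum_mono pair) blast+
  ultimately have "real CARD('n) + real CARD('m) + 1 \<le> aux_objective ?s"
    unfolding aux_objective_pairs using \<open>1 \<le> k * w\<close> by (simp add: inf_real_def)
  with feas show thesis by (rule that)
qed

text \<open>Both scales in the duality gap are \<open>w1 + w2\<close>, and the last equation of the
  program makes the gap 0. Hence in each pair one total vanishes, together with its second part, and
  the other second part is at most 1.\<close>

lemma aux_feasible_complementary:
  fixes A :: "real ^ 'n ^ 'm"
  assumes "(p, q, x1, x2, u1, u2, y1, y2, v1, v2, w1, w2) \<in> aux_feasible A b c d \<alpha> \<beta>"
  shows "(x1 + x2) \<bullet> (v1 + v2) = 0" "(y1 + y2) \<bullet> (u1 + u2) = 0"
    "x2 $ j + v2 $ j \<le> 1" "y2 $ i + u2 $ i \<le> 1"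
proof -
  from assms have *: "A *v (x1 + x2) + (u1 + u2) = p *\<^sub>R b"
    "d \<bullet> (x1 + x2) + \<beta> * p = w1 + w2"
    "transpose A *v (y1 + y2) + q *\<^sub>R d - (v1 + v2) = (w1 + w2) *\<^sub>R c"
    "- (b \<bullet> (y1 + y2)) + \<beta> * q = \<alpha> * (w1 + w2)"
    "c \<bullet> (x1 + x2) + \<alpha> * p = q"
    and nn: "0 \<le> x1" "0 \<le> u1" "0 \<le> y1" "0 \<le> v1" "0 \<le> x2" "0 \<le> u2" "0 \<le> y2" "0 \<le> v2"
      "x2 \<le> 1" "u2 \<le> 1" "y2 \<le> 1" "v2 \<le> 1"
    unfolding aux_feasible_def by (auto simp: algebra_simps simp del: transpose_matrix_vector)
  have "(x1 + x2) \<bullet> (v1 + v2) + (y1 + y2) \<bullet> (u1 + u2) = 0"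
    using duality_gap_homogeneous[OF *(1-4)] *(5) by simp
  then show comp: "(x1 + x2) \<bullet> (v1 + v2) = 0" "(y1 + y2) \<bullet> (u1 + u2) = 0"
    using nn by (auto intro: nonneg_inner_sum_eq_0)
  have one_zero: "a = 0 \<or> b = 0" if "(a' + a) * (b' + b) = 0" "0 \<le> a" "0 \<le> a'" "0 \<le> b" "0 \<le> b'"
    for a a' b b' :: real
    using that by auto
  have "x2 $ j = 0 \<or> v2 $ j = 0"
    using nonneg_inner_eq_0D[OF comp(1), of j] nn
    by (intro one_zero[of "x1 $ j" _ "v1 $ j"]) (auto simp: less_eq_vec_def)
  then show "x2 $ j + v2 $ j \<le> 1"
    using nn by (auto simp: less_eq_vec_def)
  have "y2 $ i = 0 \<or> u2 $ i = 0"
    using nonneg_inner_eq_0D[OF comp(2), of i] nn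
    by (intro one_zero[of "y1 $ i" _ "u1 $ i"]) (auto simp: less_eq_vec_def)
  then show "y2 $ i + u2 $ i \<le> 1"
    using nn by (auto simp: less_eq_vec_def)
qed

text \<open>The nonnegative slacks \<open>1 - f i\<close>, \<open>1 - g j\<close> and
  \<open>1 - r\<close> have total at most 0. It turns attainment of the bound into equality in every
  pair.\<close>

lemma sum_ge_card_imp_eq_1:
  fixes f :: "'a::finite \<Rightarrow> real" and g :: "'b::finite \<Rightarrow> real"
  assumes "real CARD('a) + real CARD('b) + 1 \<le> sum f UNIV + sum g UNIV + r"
    and "\<And>i. f i \<le> 1" "\<And>j. g j \<le> 1" "r \<le> 1"
  shows "f i = 1" "g j = 1" "r = 1"
proof -
  have "(\<Sum>i\<in>UNIV. 1 - f i) + (\<Sum>j\<in>UNIV. 1 - g j) + (1 - r) \<le> 0"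
    using assms(1) by (simp add: sum_subtractf)
  moreover have "0 \<le> (\<Sum>i\<in>UNIV. 1 - f i)" "0 \<le> (\<Sum>j\<in>UNIV. 1 - g j)" "0 \<le> 1 - r"
    using assms by (auto intro!: sum_nonneg)
  ultimately have "(\<Sum>i\<in>UNIV. 1 - f i) = 0" "(\<Sum>j\<in>UNIV. 1 - g j) = 0" "1 - r = 0"
    by linarith+
  then show "f i = 1" "g j = 1" "r = 1"
    using assms by (simp_all add: sum_nonneg_eq_0_iff)
qed

section \<open>The optimal faces of (P) and (D)\<close>

text \<open>Weak duality: both scales are 1, and the gap splits into the two complementarity
  products.\<close>

lemma P_D_gap:
  assumes "(x, t, u) \<in> P_feasible A b d \<beta>" "(y, z, v) \<in> D_feasible A b c d \<alpha> \<beta>"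
  shows "x \<bullet> v + y \<bullet> u = z - (c \<bullet> x + \<alpha> * t)" "0 \<le> x \<bullet> v" "0 \<le> y \<bullet> u"
  using assms duality_gap_homogeneous[of A x u t b d \<beta> 1 y z v 1 c \<alpha>]
  by (auto simp: P_feasible_def D_feasible_def intro: inner_nonneg_nonneg)

text \<open>The given pair has zero gap, so \<open>z\<close> is the common optimal value. A feasible
  point of either program is then optimal exactly when its gap against the fixed partner vanishes,
  that is, when both nonnegative products do.\<close>

lemma
  assumes P: "(x, t, u) \<in> P_feasible A b d \<beta>" and D: "(y, z, v) \<in> D_feasible A b c d \<alpha> \<beta>"
    and comp: "x \<bullet> v = 0" "y \<bullet> u = 0"
  shows P_optimal_iff_complementary: "(x', t', u') \<in> P_optimal A b c d \<alpha> \<beta> \<longleftrightarrow>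
      (x', t', u') \<in> P_feasible A b d \<beta> \<and> x' \<bullet> v = 0 \<and> y \<bullet> u' = 0"
    and D_optimal_iff_complementary: "(y', z', v') \<in> D_optimal A b c d \<alpha> \<beta> \<longleftrightarrow>
      (y', z', v') \<in> D_feasible A b c d \<alpha> \<beta> \<and> x \<bullet> v' = 0 \<and> y' \<bullet> u = 0"
proof -
  have z: "c \<bullet> x + \<alpha> * t = z"
    using P_D_gap[OF P D] comp by simp
  have weak: "c \<bullet> x' + \<alpha> * t' \<le> z'"
    if "(x', t', u') \<in> P_feasible A b d \<beta>" "(y', z', v') \<in> D_feasible A b c d \<alpha> \<beta>"
    for x' t' u' y' z' v'
    using P_D_gap[OF that] by simp
  have "(x', t', u') \<in> P_optimal A b c d \<alpha> \<beta> \<longleftrightarrow>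
      (x', t', u') \<in> P_feasible A b d \<beta> \<and> c \<bullet> x' + \<alpha> * t' = z"
  proof
    assume *: "(x', t', u') \<in> P_optimal A b c d \<alpha> \<beta>"
    then have "(x', t', u') \<in> P_feasible A b d \<beta>"
      by (simp add: P_optimal_def is_arg_max_def)
    moreover have "z \<le> c \<bullet> x' + \<alpha> * t'"
      using * P z by (auto simp: P_optimal_def is_arg_max_linorder)
    ultimately show "(x', t', u') \<in> P_feasible A b d \<beta> \<and> c \<bullet> x' + \<alpha> * t' = z"
      using weak[OF _ D] by (simp add: antisym)
  next
    assume "(x', t', u') \<in> P_feasible A b d \<beta> \<and> c \<bullet> x' + \<alpha> * t' = z"
    then show "(x', t', u') \<in> P_optimal A b c d \<alpha> \<beta>"
      using weak[OF _ D] by (auto simp: P_optimal_def is_arg_max_linorder)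
  qed
  then show "(x', t', u') \<in> P_optimal A b c d \<alpha> \<beta> \<longleftrightarrow>
      (x', t', u') \<in> P_feasible A b d \<beta> \<and> x' \<bullet> v = 0 \<and> y \<bullet> u' = 0"
    using P_D_gap[OF _ D, of x' t' u'] by auto
  have "(y', z', v') \<in> D_optimal A b c d \<alpha> \<beta> \<longleftrightarrow>
      (y', z', v') \<in> D_feasible A b c d \<alpha> \<beta> \<and> z' = z"
  proof
    assume *: "(y', z', v') \<in> D_optimal A b c d \<alpha> \<beta>"
    then have "(y', z', v') \<in> D_feasible A b c d \<alpha> \<beta>"
      by (simp add: D_optimal_def is_arg_min_def)
    moreover have "z' \<le> z"
      using * D by (auto simp: D_optimal_def is_arg_min_linorder)
    ultimately show "(y', z', v') \<in> D_feasible A b c d \<alpha> \<beta> \<and> z' = z"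
      using weak[OF P] z by (force intro: antisym)
  next
    assume "(y', z', v') \<in> D_feasible A b c d \<alpha> \<beta> \<and> z' = z"
    then show "(y', z', v') \<in> D_optimal A b c d \<alpha> \<beta>"
      using weak[OF P] z by (auto simp: D_optimal_def is_arg_min_linorder)
  qed
  then show "(y', z', v') \<in> D_optimal A b c d \<alpha> \<beta> \<longleftrightarrow>
      (y', z', v') \<in> D_feasible A b c d \<alpha> \<beta> \<and> x \<bullet> v' = 0 \<and> y' \<bullet> u = 0"
    using P_D_gap[OF P, of y' z' v' c \<alpha>] z by auto
qed

text \<open>Complementarity with the fixed partner only forces some entries to be 0. Strictness
  makes all the other sign constraints strict at the point, so they survive small moves inside the
  affine space of the face.\<close>

lemma strict_complementary_rel_interior:
  fixes A :: "real ^ 'n ^ 'm"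
  assumes P: "(x, t, u) \<in> P_feasible A b d \<beta>" and D: "(y, z, v) \<in> D_feasible A b c d \<alpha> \<beta>"
    and comp: "x \<bullet> v = 0" "y \<bullet> u = 0" and "0 < t"
    and strict: "\<And>j. 0 < (x + v) $ j" "\<And>i. 0 < (y + u) $ i"
  shows "(x, t, u) \<in> rel_interior (P_optimal A b c d \<alpha> \<beta>)"
    and "(y, z, v) \<in> rel_interior (D_optimal A b c d \<alpha> \<beta>)"
proof -
  note opt = P_optimal_iff_complementary[OF P D comp] D_optimal_iff_complementary[OF P D comp]
  have nn: "0 \<le> x" "0 \<le> u" "0 \<le> y" "0 \<le> v"
    using P D by (auto simp: P_feasible_def D_feasible_def)
  \<comment> \<open>These two facts recover complementarity and nonnegativity from the entrywise
    conditions of \<open>?L\<close> and \<open>?U\<close>.\<close>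
  have inner0: "r \<bullet> s = 0" if "\<forall>j. s $ j \<noteq> 0 \<longrightarrow> r $ j = 0" for r s :: "real ^ 'k"
    unfolding inner_vec_def using that by (intro sum.neutral) auto
  have nonneg: "0 \<le> r" if "\<forall>j. s $ j \<noteq> 0 \<longrightarrow> r $ j = 0" "\<forall>j. s $ j = 0 \<longrightarrow> 0 < r $ j"
    for r s :: "real ^ 'k"
    unfolding less_eq_vec_def using that by (metis less_eq_real_def order_refl zero_index)
  show "(x, t, u) \<in> rel_interior (P_optimal A b c d \<alpha> \<beta>)"
  proof (rule rel_interior_affine_Int_open)
    \<comment> \<open>\<open>?L\<close> keeps the equations and the entries forced to 0;
      \<open>?U\<close> asks strict positivity of the remaining entries and of
      \<open>t'\<close>.\<close>
    let ?L = "{(x', t', u'). A *v x' + u' = t' *\<^sub>R b \<and> d \<bullet> x' + \<beta> * t' = 1 \<and>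
      (\<forall>j. v $ j \<noteq> 0 \<longrightarrow> x' $ j = 0) \<and> (\<forall>i. y $ i \<noteq> 0 \<longrightarrow> u' $ i = 0)}"
    let ?U = "{(x', t', u'). (\<forall>j. v $ j = 0 \<longrightarrow> 0 < x' $ j) \<and> 0 < t' \<and>
      (\<forall>i. y $ i = 0 \<longrightarrow> 0 < u' $ i)}
      :: ((real ^ 'n) \<times> real \<times> (real ^ 'm)) set"
    show "(x, t, u) \<in> P_optimal A b c d \<alpha> \<beta>"
      using opt P comp by blast
    show "P_optimal A b c d \<alpha> \<beta> \<subseteq> ?L"
    proof (rule subsetI)
      fix s assume "s \<in> P_optimal A b c d \<alpha> \<beta>"
      moreover obtain x' t' u' where s: "s = (x', t', u')"
        by (metis prod.exhaust)
      ultimately have "(x', t', u') \<in> P_feasible A b d \<beta>" "x' \<bullet> v = 0" "y \<bullet> u' = 0"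
        using opt by auto
      then show "s \<in> ?L"
        using nn nonneg_inner_eq_0D[of x' v] nonneg_inner_eq_0D[of y u']
        by (auto simp: s P_feasible_def)
    qed
    show "affine ?L"
      unfolding affine_def
    proof (intro ballI allI impI)
      fix s s' :: "(real ^ 'n) \<times> real \<times> (real ^ 'm)" and a e :: real
      assume L: "s \<in> ?L" "s' \<in> ?L" and ae: "a + e = 1"
      obtain x1 t1 u1 x2 t2 u2 where s: "s = (x1, t1, u1)" "s' = (x2, t2, u2)"
        by (metis prod.exhaust)
      have "A *v (a *\<^sub>R x1 + e *\<^sub>R x2) + (a *\<^sub>R u1 + e *\<^sub>R u2)
          = a *\<^sub>R (A *v x1 + u1) + e *\<^sub>R (A *v x2 + u2)"
        by (simp add: matrix_vector_right_distrib matrix_vector_mult_scaleR scaleR_add_right)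
      also have "\<dots> = (a * t1 + e * t2) *\<^sub>R b"
        using L by (simp add: s scaleR_add_left)
      finally have 1: "A *v (a *\<^sub>R x1 + e *\<^sub>R x2) + (a *\<^sub>R u1 + e *\<^sub>R u2) = (a * t1 + e * t2) *\<^sub>R b" .
      have "d \<bullet> (a *\<^sub>R x1 + e *\<^sub>R x2) + \<beta> * (a * t1 + e * t2)
          = a * (d \<bullet> x1 + \<beta> * t1) + e * (d \<bullet> x2 + \<beta> * t2)"
        by (simp add: inner_add_right algebra_simps)
      also have "\<dots> = 1"
        using L ae by (simp add: s)
      finally show "a *\<^sub>R s + e *\<^sub>R s' \<in> ?L"
        using 1 L by (simp add: s)
    qed
    show "open ?U"
      unfolding split_beta
      by (intro open_Collect_conj open_Collect_all_finite open_Collect_imp open_Collect_less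
          closed_Collect_const continuous_intros)
    show "(x, t, u) \<in> ?U"
      using strict \<open>0 < t\<close> by (auto; metis add.right_neutral add.left_neutral)
    show "?U \<inter> ?L \<subseteq> P_optimal A b c d \<alpha> \<beta>"
      using inner0[of v] nonneg[of v] inner0[of y] nonneg[of y]
      by (auto simp: opt P_feasible_def inner_commute[of y])
  qed
  show "(y, z, v) \<in> rel_interior (D_optimal A b c d \<alpha> \<beta>)"
  proof (rule rel_interior_affine_Int_open)
    \<comment> \<open>As for (P) with the roles exchanged; \<open>z'\<close> is free in sign and
      gets no condition in \<open>?U\<close>.\<close>
    let ?L = "{(y', z', v'). transpose A *v y' + z' *\<^sub>R d - v' = c \<and> - (b \<bullet> y') + \<beta> * z' = \<alpha> \<and>
      (\<forall>i. u $ i \<noteq> 0 \<longrightarrow> y' $ i = 0) \<and> (\<forall>j. x $ j \<noteq> 0 \<longrightarrow> v' $ j = 0)}"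
    let ?U = "{(y', z', v'). (\<forall>i. u $ i = 0 \<longrightarrow> 0 < y' $ i) \<and> (\<forall>j. x $ j = 0 \<longrightarrow> 0 < v' $ j)}
      :: ((real ^ 'm) \<times> real \<times> (real ^ 'n)) set"
    show "(y, z, v) \<in> D_optimal A b c d \<alpha> \<beta>"
      using opt D comp by blast
    show "D_optimal A b c d \<alpha> \<beta> \<subseteq> ?L"
    proof (rule subsetI)
      fix s assume "s \<in> D_optimal A b c d \<alpha> \<beta>"
      moreover obtain y' z' v' where s: "s = (y', z', v')"
        by (metis prod.exhaust)
      ultimately have "(y', z', v') \<in> D_feasible A b c d \<alpha> \<beta>" "x \<bullet> v' = 0" "y' \<bullet> u = 0"
        using opt by auto
      then show "s \<in> ?L"
        using nn nonneg_inner_eq_0D[of x v'] nonneg_inner_eq_0D[of y' u]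
        by (auto simp: s D_feasible_def)
    qed
    show "affine ?L"
      unfolding affine_def
    proof (intro ballI allI impI)
      fix s s' :: "(real ^ 'm) \<times> real \<times> (real ^ 'n)" and a e :: real
      assume L: "s \<in> ?L" "s' \<in> ?L" and ae: "a + e = 1"
      obtain y1 z1 v1 y2 z2 v2 where s: "s = (y1, z1, v1)" "s' = (y2, z2, v2)"
        by (metis prod.exhaust)
      have "transpose A *v (a *\<^sub>R y1 + e *\<^sub>R y2) + (a * z1 + e * z2) *\<^sub>R d - (a *\<^sub>R v1 + e *\<^sub>R v2)
          = a *\<^sub>R (transpose A *v y1 + z1 *\<^sub>R d - v1) + e *\<^sub>R (transpose A *v y2 + z2 *\<^sub>R d - v2)"
        by (simp add: matrix_vector_right_distrib matrix_vector_mult_scaleR algebra_simps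
            del: transpose_matrix_vector)
      also have "\<dots> = (a + e) *\<^sub>R c"
        using L by (simp add: s scaleR_add_left del: transpose_matrix_vector)
      finally have 1: "transpose A *v (a *\<^sub>R y1 + e *\<^sub>R y2) + (a * z1 + e * z2) *\<^sub>R d
          - (a *\<^sub>R v1 + e *\<^sub>R v2) = c"
        using ae by simp
      have "- (b \<bullet> (a *\<^sub>R y1 + e *\<^sub>R y2)) + \<beta> * (a * z1 + e * z2)
          = a * (- (b \<bullet> y1) + \<beta> * z1) + e * (- (b \<bullet> y2) + \<beta> * z2)"
        by (simp add: inner_add_right algebra_simps)
      also have "\<dots> = (a + e) * \<alpha>"
        using L by (simp add: s distrib_right)
      finally show "a *\<^sub>R s + e *\<^sub>R s' \<in> ?L"
        using 1 L ae by (simp add: s del: transpose_matrix_vector)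
    qed
    show "open ?U"
      unfolding split_beta
      by (intro open_Collect_conj open_Collect_all_finite open_Collect_imp open_Collect_less
          closed_Collect_const continuous_intros)
    show "(y, z, v) \<in> ?U"
      using strict by (auto; metis add.right_neutral add.left_neutral)
    show "?U \<inter> ?L \<subseteq> D_optimal A b c d \<alpha> \<beta>"
    proof (rule subsetI)
      fix s assume s: "s \<in> ?U \<inter> ?L"
      obtain y' z' v' where eq: "s = (y', z', v')"
        by (metis prod.exhaust)
      have "0 \<le> y'" "y' \<bullet> u = 0" "0 \<le> v'" "v' \<bullet> x = 0"
        using s inner0[of u y'] nonneg[of u y'] inner0[of x v'] nonneg[of x v'] by (auto simp: eq)
      with s show "s \<in> D_optimal A b c d \<alpha> \<beta>"
        unfolding eq opt(2) by (simp add: D_feasible_def inner_commute)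
    qed
  qed
qed

section \<open>Dehomogenising an optimal auxiliary solution\<close>

theorem mainTheorem4:
  fixes A :: "real ^ 'n ^ 'm" and b :: "real ^ 'm" and c d :: "real ^ 'n" and \<alpha> \<beta> :: real
    and p q w1 w2 t z :: real
    and x1 x2 v1 v2 x v :: "real ^ 'n"
    and u1 u2 y1 y2 u y :: "real ^ 'm"
  assumes "lfp_feasible A b \<noteq> {}" and "bounded (lfp_feasible A b)"
    and "\<forall>x \<in> lfp_feasible A b. d \<bullet> x + \<beta> > 0"
    and "is_arg_max aux_objective (\<lambda>s. s \<in> aux_feasible A b c d \<alpha> \<beta>)
           (p, q, x1, x2, u1, u2, y1, y2, v1, v2, w1, w2)"
    and "(x, t, u) = (1 / (w1 + 1)) *\<^sub>R (x1 + x2, p, u1 + u2)"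
    and "(y, z, v) = (1 / (w1 + 1)) *\<^sub>R (y1 + y2, q, v1 + v2)"
  shows "(x, t, u) \<in> rel_interior (P_optimal A b c d \<alpha> \<beta>) \<and>
         (y, z, v) \<in> rel_interior (D_optimal A b c d \<alpha> \<beta>) \<and>
         t \<noteq> 0 \<and>
         strict_complementary A b c d \<alpha> \<beta> ((1 / t) *\<^sub>R (x, u), (y, z, v))"
proof -
  let ?s = "(p, q, x1, x2, u1, u2, y1, y2, v1, v2, w1, w2)"
  have feas: "?s \<in> aux_feasible A b c d \<alpha> \<beta>"
    and max: "\<And>s. s \<in> aux_feasible A b c d \<alpha> \<beta> \<Longrightarrow> aux_objective s \<le> aux_objective ?s"
    using assms(4) by (simp_all only: is_arg_max_linorder simp_thms)
  obtain s where "s \<in> aux_feasible A b c d \<alpha> \<beta>" "real CARD('n) + real CARD('m) + 1 \<le> aux_objective s"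
    by (rule aux_feasible_large[OF assms(1-3), of c \<alpha>])
  then have "real CARD('n) + real CARD('m) + 1 \<le> aux_objective ?s"
    using max by (meson order_trans)
  note large = this[unfolded aux_objective_pairs]
  have "w2 \<le> 1"
    using feas by (simp add: aux_feasible_def)
  \<comment> \<open>The upper bound is attained, so every pair of second parts sums to 1 and
    \<open>w2 = 1\<close>.\<close>
  note one = sum_ge_card_imp_eq_1[OF large aux_feasible_complementary(3,4)[OF feas] this]
  \<comment> \<open>As \<open>w2 = 1\<close>, the denominator is the full homogenising scale
    \<open>w1 + w2\<close>; dividing by it gives points of (P) and (D).\<close>
  define k where "k = 1 / (w1 + 1)"
  have xtu: "x = k *\<^sub>R (x1 + x2)" "t = k * p" "u = k *\<^sub>R (u1 + u2)"
    and yzv: "y = k *\<^sub>R (y1 + y2)" "z = k * q" "v = k *\<^sub>R (v1 + v2)"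
    using assms(5,6) by (auto simp: k_def)
  have eqs: "A *v (x1 + x2) + (u1 + u2) = p *\<^sub>R b"
    "d \<bullet> (x1 + x2) + \<beta> * p = w1 + 1"
    "transpose A *v (y1 + y2) + q *\<^sub>R d - (v1 + v2) = (w1 + 1) *\<^sub>R c"
    "- (b \<bullet> (y1 + y2)) + \<beta> * q = \<alpha> * (w1 + 1)"
    and nn: "0 \<le> p" "0 \<le> x1" "0 \<le> u1" "0 \<le> y1" "0 \<le> v1" "0 \<le> w1"
      "0 \<le> x2" "0 \<le> u2" "0 \<le> y2" "0 \<le> v2"
    using feas one(3) unfolding aux_feasible_def
    by (auto simp: algebra_simps simp del: transpose_matrix_vector)
  have k: "0 < k" "k * (w1 + 1) = 1"
    using \<open>0 \<le> w1\<close> by (auto simp: k_def)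
  have "A *v x + u = k *\<^sub>R (A *v (x1 + x2) + (u1 + u2))"
    unfolding xtu by (simp only: matrix_vector_mult_scaleR matrix_vector_right_distrib scaleR_add_right)
  then have "A *v x + u = t *\<^sub>R b"
    unfolding eqs xtu by simp
  moreover have "d \<bullet> x + \<beta> * t = k * (d \<bullet> (x1 + x2) + \<beta> * p)"
    unfolding xtu by (simp add: algebra_simps)
  then have "d \<bullet> x + \<beta> * t = 1"
    unfolding eqs k .
  ultimately have P: "(x, t, u) \<in> P_feasible A b d \<beta>"
    using nn k by (simp add: P_feasible_def xtu scaleR_nonneg_nonneg)
  have "transpose A *v y + z *\<^sub>R d - v = k *\<^sub>R (transpose A *v (y1 + y2) + q *\<^sub>R d - (v1 + v2))"
    unfolding yzv by (simp only: matrix_vector_mult_scaleR matrix_vector_right_distrib scaleR_add_right scaleR_diff_right scaleR_scaleR)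
  then have "transpose A *v y + z *\<^sub>R d - v = c"
    unfolding eqs using k by simp
  moreover have "- (b \<bullet> y) + \<beta> * z = k * (- (b \<bullet> (y1 + y2)) + \<beta> * q)"
    unfolding yzv by (simp add: algebra_simps)
  then have "- (b \<bullet> y) + \<beta> * z = \<alpha>"
    unfolding eqs using k by (simp add: mult.left_commute)
  ultimately have D: "(y, z, v) \<in> D_feasible A b c d \<alpha> \<beta>"
    using nn k by (simp add: D_feasible_def yzv scaleR_nonneg_nonneg del: transpose_matrix_vector)
  have comp: "x \<bullet> v = 0" "y \<bullet> u = 0"
    unfolding xtu yzv using aux_feasible_complementary(1,2)[OF feas] by simp_all
  have strict: "0 < (x + v) $ j" "0 < (y + u) $ i" for i j
  proof -
    have "0 < k * (x1 $ j + v1 $ j + (x2 $ j + v2 $ j))" "0 < k * (y1 $ i + u1 $ i + (y2 $ i + u2 $ i))"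
      using nn k unfolding one by (auto simp: less_eq_vec_def intro!: mult_pos_pos add_nonneg_pos)
    then show "0 < (x + v) $ j" "0 < (y + u) $ i"
      unfolding xtu yzv by (simp_all add: algebra_simps)
  qed
  \<comment> \<open>With \<open>t = 0\<close> the vector \<open>x\<close> would be a recession
    direction, hence 0, against \<open>d \<bullet> x = 1\<close>.\<close>
  have "0 < t"
  proof (rule ccontr)
    assume "\<not> 0 < t"
    with P have "t = 0" by (simp add: P_feasible_def)
    with P have "A *v x = - u" "0 \<le> u" "0 \<le> x" "d \<bullet> x = 1"
      by (auto simp: P_feasible_def eq_neg_iff_add_eq_0)
    then have "x = 0"
      by (intro bounded_lfp_recession_zero[OF assms(1,2)]) auto
    with \<open>d \<bullet> x = 1\<close> show False by simp
  qed
  have "strict_complementary A b c d \<alpha> \<beta> ((1 / t) *\<^sub>R (x, u), (y, z, v))"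
  proof -
    let ?x = "(1 / t) *\<^sub>R x" and ?u = "(1 / t) *\<^sub>R u"
    have nn: "0 \<le> x" "0 \<le> u" "0 \<le> y" "0 \<le> v"
      using P D by (auto simp: P_feasible_def D_feasible_def)
    have nn': "0 \<le> ?x" "0 \<le> ?u"
      using nn \<open>0 < t\<close> by (simp_all add: scaleR_nonneg_nonneg)
    have "A *v ?x + ?u = (1 / t) *\<^sub>R (A *v x + u)"
      by (simp add: matrix_vector_mult_scaleR scaleR_add_right)
    also have "\<dots> = b"
      using P \<open>0 < t\<close> by (simp add: P_feasible_def)
    finally have b: "?u = b - A *v ?x"
      by (simp add: algebra_simps)
    then have x: "?x \<in> lfp_feasible A b"
      using nn' by (simp add: lfp_feasible_def)
    have v: "v = transpose A *v y + z *\<^sub>R d - c" and bz: "- (b \<bullet> y) + \<beta> * z = \<alpha>"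
      using D by (auto simp: D_feasible_def)
    have "0 \<le> transpose A *v y + z *\<^sub>R d - c"
      using nn(4) v by simp
    then have y: "(y, z) \<in> lfp_dual_feasible A b c d \<alpha> \<beta>"
      using nn bz by (simp add: lfp_dual_feasible_def del: transpose_matrix_vector)
    \<comment> \<open>Only the primal vectors are divided by \<open>t\<close>, so strict positivity
      must be shown to survive rescaling one summand.\<close>
    have "0 < r / t + s" if "0 < r + s" "0 \<le> r" "0 \<le> s" for r s :: real
      using that \<open>0 < t\<close> by (cases "r = 0") (auto intro: add_pos_nonneg)
    then have "0 < (?x + v) $ j" "0 < (y + ?u) $ i" for i j
      using strict nn by (simp_all add: less_eq_vec_def add.commute)
    moreover have "?x \<bullet> v = 0" "y \<bullet> ?u = 0"
      using comp by simp_all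
    ultimately show ?thesis
      using x y b v unfolding strict_complementary_def feasible_primal_dual_def scaleR_Pair prod.case
      by blast
  qed
  with strict_complementary_rel_interior[OF P D comp \<open>0 < t\<close> strict] \<open>0 < t\<close> show ?thesis
    by simp
qed

end
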